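(* Consider the pricing game PADD described in the context under linear pricing ($\mathcal{P}=\mathcal{P}_L$). When the seller's cost $c$ is convex and differentiable, the piecewise linear concave value function $$u^*(\mathbf{x})=p^*\cdot\min\Big\{\frac{x_1}{x_1^*},\dots,\frac{x_d}{x_d^*},1\Big\},\quad\text{with } p^*=\mathbf{x}^*\cdot\nabla c(\mathbf{x}^* )\ \text{ and }\ \mathbf{x}^*=\arg\max_{\mathbf{x}\in X}\,[v(\mathbf{x})-\mathbf{x}\cdot\nabla c(\mathbf{x})],$$ is an optimal buyer imitative value function. Under $u^*$, the trade happens at bundle $\mathbf{x}^*$ with payment $p^*=\mathbf{x}^*\cdot\nabla c(\mathbf{x}^* )$. The seller revenue $\mathbf{x}^*\cdot\nabla c(\mathbf{x}^* )-c(\mathbf{x}^* )$ is precisely the Bregman divergence $D_c(\mathbf{0},\mathbf{x}^* )$ between $\mathbf{0}$ and $\mathbf{x}^*$. The buyer surplus is $v(\mathbf{x}^* )-\mathbf{x}^*\cdot\nabla c(\mathbf{x}^* )$.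
   Context: Setting. A seller sells $d$ types of divisible goods to a buyer. $X\subset\mathbb{R}_+^d$ is the set of feasible bundles; $X$ is convex, closed, of positive measure, and $\mathbf{0}\in X$. The seller's production cost $c(\mathbf{x})$, $\mathbf{x}\in X$, is monotone non-decreasing with $c(\mathbf{0})=0$. The buyer's true value function $v(\mathbf{x})$, $\mathbf{x}\in X$, is concave and monotone non-decreasing with $v(\mathbf{0})=0$. $\mathcal{C}$ is the set of all concave, monotone non-decreasing functions $u:X\to\mathbb{R}_+$ with $u(\mathbf{0})=0$ (the possible imitative value functions). A pricing function $p$ assigns a price $p(\mathbf{x})$ to each bundle, with $p(\mathbf{0})=0$; $\mathcal{P}$ denotes the class of pricing functions available to the seller. $\mathcal{P}_L=\{p: p(\mathbf{x})=\mathbf{p}\cdot\mathbf{x}\text{ for some }\mathbf{p}\in\mathbb{R}_+^d\}$ is the class of linear pricing functions. The game PADD. The buyer, whose true value function $v$ is unknown to the seller, commits to react optimally according to an imitative value function $u\in\mathcal{C}$. The seller learns $u$ and chooses a revenue-maximizing $p_u\in\mathcal{P}$ against it, i.e. $p_u=\arg\max_{p\in\mathcal{P}}[p(\mathbf{x}_u(p))-c(\mathbf{x}_u(p))]$, where $\mathbf{x}_u(p)=\arg\max_{\mathbf{x}\in X}[u(\mathbf{x})-p(\mathbf{x})]$ is the bundle the buyer then purchases, with buyer ties broken in favor of the seller. The trade happens at bundle $\mathbf{x}_u(p_u)$ with payment $p_u(\mathbf{x}_u(p_u))$. An optimal imitative value function is a maximizer $u\in\mathcal{C}$ of the true buyer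 utility $v(\mathbf{x}_u(p_u))-p_u(\mathbf{x}_u(p_u))$. The buyer surplus is this true buyer utility, and the seller revenue is the payment minus the production cost of the purchased bundle. The Bregman divergence of a differentiable function $f$ is $D_f(\mathbf{z},\mathbf{x})=f(\mathbf{z})-f(\mathbf{x})-\nabla f(\mathbf{x})\cdot[\mathbf{z}-\mathbf{x}]$. *)

theory Defs
  imports "HOL-Analysis.Analysis"
begin

text \<open>Bundles are vectors in \<open>real ^ 'd\<close>, ordered componentwise; value, cost and pricing functions are
  total functions of which only the values on the feasible set \<open>X\<close> matter.\<close>

definition feasible_set :: "(real ^ 'd) set \<Rightarrow> bool" where
  "feasible_set X \<longleftrightarrow>
     X \<subseteq> {x. 0 \<le> x} \<and> convex X \<and> closed X \<and> 0 < emeasure lebesgue X \<and> 0 \<in> X"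

definition imitative_values :: "(real ^ 'd) set \<Rightarrow> (real ^ 'd \<Rightarrow> real) set" where
  "imitative_values X = {u. concave_on X u \<and> mono_on X u \<and> (\<forall>x\<in>X. 0 \<le> u x) \<and> u 0 = 0}"

definition linear_pricing :: "(real ^ 'd \<Rightarrow> real) set" where
  "linear_pricing = {p. \<exists>w. 0 \<le> w \<and> p = (\<lambda>x. w \<bullet> x)}"

definition best_responses ::
  "(real ^ 'd) set \<Rightarrow> (real ^ 'd \<Rightarrow> real) \<Rightarrow> (real ^ 'd \<Rightarrow> real) \<Rightarrow> (real ^ 'd) set" where
  "best_responses X u p = {x. is_arg_max (\<lambda>y. u y - p y) (\<lambda>y. y \<in> X) x}"

definition seller_revenue ::
  "(real ^ 'd \<Rightarrow> real) \<Rightarrow> (real ^ 'd \<Rightarrow> real) \<Rightarrow> real ^ 'd \<Rightarrow> real" where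
  "seller_revenue c p x = p x - c x"

definition buyer_surplus ::
  "(real ^ 'd \<Rightarrow> real) \<Rightarrow> (real ^ 'd \<Rightarrow> real) \<Rightarrow> real ^ 'd \<Rightarrow> real" where
  "buyer_surplus v p x = v x - p x"

text \<open>The purchased bundle: a best response, ties being broken in favour of the seller.\<close>

definition purchases ::
  "(real ^ 'd) set \<Rightarrow> (real ^ 'd \<Rightarrow> real) \<Rightarrow> (real ^ 'd \<Rightarrow> real) \<Rightarrow> (real ^ 'd \<Rightarrow> real) \<Rightarrow> real ^ 'd \<Rightarrow> bool" where
  "purchases X c u p x \<longleftrightarrow> is_arg_max (seller_revenue c p) (\<lambda>y. y \<in> best_responses X u p) x"

text \<open>The revenue a price yields under this tie-breaking. It is a supremum because members of
  \<^const>\<open>imitative_values\<close> may be discontinuous on the boundary of \<open>X\<close>, so that the seller's favourite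
  best response need not exist; a price without any best response has value \<open>-\<infinity>\<close>.\<close>

definition price_value ::
  "(real ^ 'd) set \<Rightarrow> (real ^ 'd \<Rightarrow> real) \<Rightarrow> (real ^ 'd \<Rightarrow> real) \<Rightarrow> (real ^ 'd \<Rightarrow> real) \<Rightarrow> ereal" where
  "price_value X c u p = (SUP x \<in> best_responses X u p. ereal (seller_revenue c p x))"

text \<open>\<open>p\<close> and \<open>x\<close> are a possible outcome of the game with price class \<open>P\<close> once the buyer has committed
  to \<open>u\<close>. An outcome need not exist or be unique.\<close>

definition trade ::
  "(real ^ 'd) set \<Rightarrow> (real ^ 'd \<Rightarrow> real) \<Rightarrow> (real ^ 'd \<Rightarrow> real) set \<Rightarrow> (real ^ 'd \<Rightarrow> real)
    \<Rightarrow> (real ^ 'd \<Rightarrow> real) \<Rightarrow> real ^ 'd \<Rightarrow> bool" where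
  "trade X c P u p x \<longleftrightarrow>
     is_arg_max (price_value X c u) (\<lambda>q. q \<in> P) p \<and> purchases X c u p x"

text \<open>\<open>u\<close> is an optimal imitative value function, as realised by the outcome \<open>p\<close>, \<open>x\<close>: no outcome of any
  imitative value function is better for the buyer with true value function \<open>v\<close>.\<close>

definition optimal_imitation ::
  "(real ^ 'd) set \<Rightarrow> (real ^ 'd \<Rightarrow> real) \<Rightarrow> (real ^ 'd \<Rightarrow> real) set \<Rightarrow> (real ^ 'd \<Rightarrow> real)
    \<Rightarrow> (real ^ 'd \<Rightarrow> real) \<Rightarrow> (real ^ 'd \<Rightarrow> real) \<Rightarrow> real ^ 'd \<Rightarrow> bool" where
  "optimal_imitation X c P v u p x \<longleftrightarrow>
     u \<in> imitative_values X \<and> trade X c P u p x \<and>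
     (\<forall>u' \<in> imitative_values X. \<forall>p' x'. trade X c P u' p' x' \<longrightarrow>
        buyer_surplus v p' x' \<le> buyer_surplus v p x)"

text \<open>The derivative is taken within \<open>X\<close>, which allows for boundary points; it is unique there whenever
  \<open>X\<close> is convex with nonempty interior.\<close>

definition grad :: "(real ^ 'd) set \<Rightarrow> (real ^ 'd \<Rightarrow> real) \<Rightarrow> real ^ 'd \<Rightarrow> real ^ 'd" where
  "grad X f x = (\<chi> i. frechet_derivative f (at x within X) (axis i 1))"

definition bregman :: "(real ^ 'd) set \<Rightarrow> (real ^ 'd \<Rightarrow> real) \<Rightarrow> real ^ 'd \<Rightarrow> real ^ 'd \<Rightarrow> real" where
  "bregman X f z x = f z - f x - grad X f x \<bullet> (z - x)"

text \<open>The function \<open>pay * min {x\<^sub>1/a\<^sub>1, \<dots>, x\<^sub>d/a\<^sub>d, 1}\<close>, where the ratios with \<open>a\<^sub>i = 0\<close> are read as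
  \<open>+\<infinity>\<close> (also for \<open>x\<^sub>i = 0\<close>) and hence left out of the minimum.\<close>

definition leontief :: "real \<Rightarrow> real ^ 'd \<Rightarrow> real ^ 'd \<Rightarrow> real" where
  "leontief pay a x = pay * Min (insert 1 ((\<lambda>i. x $ i / a $ i) ` {i. a $ i \<noteq> 0}))"

end

theory Submission imports Defs begin

text \<open>For the upper bound on the buyer surplus, suppose that an outcome at bundle \<open>x\<close> under prices \<open>w\<close>
  has payment \<open>w \<bullet> x < x \<bullet> \<nabla>c(x)\<close>. For some \<open>\<alpha> < 1\<close> the seller then prefers to sell \<open>\<alpha> x\<close> at the
  prices \<open>w\<close>. Since \<open>\<alpha> x\<close> may lie on the boundary of \<open>X\<close>, where the imitative value function need not
  have a supergradient, move to a nearby interior point \<open>z = \<alpha> x + (1 - \<alpha>) e\<close> with \<open>e\<close> close to \<open>0\<close>.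
  A supergradient \<open>w'\<close> at \<open>z\<close> is nonnegative, is a price that makes \<open>z\<close> a best response, and concavity
  gives \<open>w' \<bullet> (x - z) \<ge> w \<bullet> (x - z)\<close>, so the payment for \<open>z\<close> is almost \<open>\<alpha> (w \<bullet> x)\<close> or more: a contradiction.

  Conversely, under the Leontief function the buyer never pays more than \<open>t p\<^sup>*\<close>, where \<open>t\<close> is the minimum
  at the purchased bundle, and that bundle costs at least
  \<open>c(t x\<^sup>*) \<ge> c(x\<^sup>*) - (1 - t) p\<^sup>*\<close>, so the revenue is at most \<open>p\<^sup>* - c(x\<^sup>*)\<close>.\<close>

section \<open>Feasible sets and derivatives towards the origin\<close>

lemma feasible_setD:
  assumes "feasible_set X"
  shows "x \<in> X \<Longrightarrow> 0 \<le> x" "convex X" "0 \<in> X" "interior X \<noteq> {}"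
proof -
  show "x \<in> X \<Longrightarrow> 0 \<le> x" "convex X" "0 \<in> X"
    using assms by (auto simp: feasible_set_def)
  \<comment> \<open>A convex set with empty interior is negligible, so positive measure yields
    interior points.\<close>
  have "\<not> negligible X"
    using assms by (auto simp: feasible_set_def negligible_iff_null_sets)
  then show "interior X \<noteq> {}"
    using assms by (auto simp: feasible_set_def negligible_convex_interior)
qed

lemma scaleR_mem_convex:
  assumes "convex X" "0 \<in> X" "x \<in> X" "0 \<le> t" "t \<le> 1"
  shows "t *\<^sub>R x \<in> X"
  using convexD_alt[OF assms(1,2,3,4,5)] by simp

text \<open>Linearity in the standard basis; this holds for whichever derivative within
  \<open>X\<close> is selected by \<open>frechet_derivative\<close>.\<close>

lemma inner_grad:
  fixes x y :: "real ^ 'd"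
  assumes "f differentiable (at x within X)"
  shows "y \<bullet> grad X f x = frechet_derivative f (at x within X) y"
proof -
  let ?D = "frechet_derivative f (at x within X)"
  have lin: "linear ?D" by (rule linear_frechet_derivative[OF assms])
  have "?D y = ?D (\<Sum>i\<in>UNIV. (y $ i) *\<^sub>R axis i 1)"
    using basis_expansion[of y] by (simp add: scalar_mult_eq_scaleR)
  also have "\<dots> = (\<Sum>i\<in>UNIV. y $ i * ?D (axis i 1))"
    by (simp add: linear_sum[OF lin] linear_scale[OF lin])
  also have "\<dots> = y \<bullet> grad X f x"
    by (simp add: inner_vec_def grad_def)
  finally show ?thesis by simp
qed

text \<open>Chain rule along the segment from \<open>x\<close> to \<open>0\<close>, which stays in
  \<open>X\<close> by convexity, so a derivative within \<open>X\<close> suffices even at boundary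
  points.\<close>

lemma ray_derivative:
  fixes x :: "real ^ 'd"
  assumes "convex X" "0 \<in> X" "x \<in> X" and "f differentiable (at x within X)"
  shows "((\<lambda>t. (f ((1 - t) *\<^sub>R x) - f x) / t) \<longlongrightarrow> - (x \<bullet> grad X f x)) (at_right 0)"
proof -
  let ?D = "frechet_derivative f (at x within X)"
  have "((\<lambda>t::real. (1 - t) *\<^sub>R x) has_derivative (\<lambda>h. - (h *\<^sub>R x))) (at 0 within {0..1})"
    by (auto intro!: derivative_eq_intros)
  moreover have "(f has_derivative ?D) (at ((1 - 0) *\<^sub>R x) within (\<lambda>t. (1 - t) *\<^sub>R x) ` {0..1})"
  proof (rule has_derivative_subset)
    show "(f has_derivative ?D) (at ((1 - 0) *\<^sub>R x) within X)"
      using assms(4) by (simp add: frechet_derivative_works)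
    show "(\<lambda>t. (1 - t) *\<^sub>R x) ` {0..1} \<subseteq> X"
      using assms(1-3) by (auto intro!: scaleR_mem_convex)
  qed
  ultimately have "(f \<circ> (\<lambda>t. (1 - t) *\<^sub>R x) has_derivative ?D \<circ> (\<lambda>h. - (h *\<^sub>R x))) (at 0 within {0..1})"
    by (rule diff_chain_within)
  moreover have "?D \<circ> (\<lambda>h. - (h *\<^sub>R x)) = (*) (- ?D x)"
    using linear_frechet_derivative[OF assms(4)]
    by (auto simp: fun_eq_iff linear_neg linear_scale)
  ultimately have "(f \<circ> (\<lambda>t. (1 - t) *\<^sub>R x) has_field_derivative - ?D x) (at 0 within {0..1})"
    by (simp add: has_field_derivative_def)
  then show ?thesis
    by (simp add: has_field_derivative_iff inner_grad[OF assms(4)] at_within_Icc_at_right)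
qed

text \<open>Shrinking a nonnegative bundle lowers it componentwise, so the difference quotients
  along the ray are nonpositive, and so is their limit.\<close>

lemma inner_grad_nonneg:
  fixes x :: "real ^ 'd"
  assumes X: "feasible_set X" and "x \<in> X" "mono_on X f" "f differentiable (at x within X)"
  shows "0 \<le> x \<bullet> grad X f x"
proof -
  have "\<forall>\<^sub>F t in at_right 0. (f ((1 - t) *\<^sub>R x) - f x) / t \<le> 0"
    using eventually_at_right_less[of "0::real"] eventually_at_right_real[of 0 "1::real", OF zero_less_one]
  proof eventually_elim
    case (elim t)
    have "(1 - t) *\<^sub>R x \<le> x"
      using elim feasible_setD(1)[OF X \<open>x \<in> X\<close>]
      by (auto simp: less_eq_vec_def mult_left_le_one_le)
    moreover have "(1 - t) *\<^sub>R x \<in> X"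
      using elim feasible_setD(2,3)[OF X] \<open>x \<in> X\<close> by (intro scaleR_mem_convex) auto
    ultimately have "f ((1 - t) *\<^sub>R x) \<le> f x"
      using mono_onD[OF assms(3)] \<open>x \<in> X\<close> by auto
    then show ?case using elim by (simp add: divide_le_0_iff)
  qed
  with ray_derivative[OF feasible_setD(2,3)[OF X] assms(2,4)]
  have "- (x \<bullet> grad X f x) \<le> 0"
    by (rule tendsto_upperbound) simp
  then show ?thesis by simp
qed

text \<open>Slopes of a convex function are monotone: the quotient for a short step \<open>r\<close>
  towards \<open>0\<close> is at most that for the step \<open>1 - t\<close>. Letting
  \<open>r\<close> tend to \<open>0\<close> gives the tangent bound.\<close>

lemma convex_on_ray_ge:
  fixes x :: "real ^ 'd"
  assumes "convex_on X f" "0 \<in> X" "x \<in> X" "f differentiable (at x within X)" "0 \<le> t" "t \<le> 1"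
  shows "f x - (1 - t) * (x \<bullet> grad X f x) \<le> f (t *\<^sub>R x)"
proof (cases "t = 1")
  case False
  define s where "s = 1 - t"
  have s: "0 < s" "s \<le> 1" using False assms(5,6) by (auto simp: s_def)
  have "convex X" using assms(1) by (rule convex_on_imp_convex)
  have tx: "t *\<^sub>R x \<in> X"
    using \<open>convex X\<close> assms(2,3,5,6) by (rule scaleR_mem_convex)
  have "\<forall>\<^sub>F r in at_right 0. (f ((1 - r) *\<^sub>R x) - f x) / r \<le> (f (t *\<^sub>R x) - f x) / s"
    using eventually_at_right_real[of 0 s, OF s(1)]
  proof eventually_elim
    case (elim r)
    have "1 - r = (1 - r / s) + (r / s) * t"
      using s by (simp add: s_def divide_simps) algebra
    then have "(1 - r) *\<^sub>R x = (1 - r / s) *\<^sub>R x + (r / s) *\<^sub>R (t *\<^sub>R x)"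
      by (simp add: scaleR_left_distrib[symmetric])
    also have "f \<dots> \<le> (1 - r / s) * f x + (r / s) * f (t *\<^sub>R x)"
      using elim s assms(3) tx by (intro convex_onD[OF assms(1)]) auto
    finally show ?case
      using elim s by (simp add: field_simps)
  qed
  with ray_derivative[OF \<open>convex X\<close> assms(2-4)]
  have "- (x \<bullet> grad X f x) \<le> (f (t *\<^sub>R x) - f x) / s"
    by (rule tendsto_upperbound) simp
  then show ?thesis using s by (simp add: s_def field_simps)
qed simp

section \<open>Supergradients at interior points\<close>

lemma concave_on_supergradient:
  fixes u :: "'a::euclidean_space \<Rightarrow> real"
  assumes "concave_on X u" and z: "z \<in> interior X"
  obtains w where "\<And>y. y \<in> X \<Longrightarrow> u y \<le> u z + w \<bullet> (y - z)"
proof -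
  \<comment> \<open>The strict hypograph leaves out \<open>(z, u z)\<close>, so this point can be
    separated from it.\<close>
  define H where "H = {q. fst q \<in> X \<and> snd q < u (fst q)}"
  have zX: "z \<in> X" using z interior_subset by auto
  have "convex H"
    unfolding convex_alt
  proof (intro ballI allI impI)
    fix p q :: "'a \<times> real" and t :: real
    assume p: "p \<in> H" and q: "q \<in> H" and t: "0 \<le> t \<and> t \<le> 1"
    have "(1 - t) * u (fst p) + t * u (fst q) \<le> u ((1 - t) *\<^sub>R fst p + t *\<^sub>R fst q)"
      using assms(1) p q t by (auto simp: H_def concave_on_iff)
    moreover have "(1 - t) * snd p + t * snd q < (1 - t) * u (fst p) + t * u (fst q)"
    \<comment> \<open>For \<open>t = 0\<close> the weight of \<open>q\<close> vanishes and
      strictness comes from \<open>p\<close>; otherwise it comes from \<open>q\<close>.\<close>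
    proof (cases "t = 0")
      case False
      then show ?thesis
        using p q t by (intro add_le_less_mono mult_left_mono mult_strict_left_mono) (auto simp: H_def)
    qed (use p in \<open>simp add: H_def\<close>)
    moreover have "(1 - t) *\<^sub>R fst p + t *\<^sub>R fst q \<in> X"
      using assms(1) p q t by (auto simp: H_def concave_on_iff intro!: convexD)
    ultimately show "(1 - t) *\<^sub>R p + t *\<^sub>R q \<in> H"
      by (auto simp: H_def)
  qed
  moreover have "(z, u z - 1) \<in> H" using zX by (simp add: H_def)
  moreover have "(z, u z) \<notin> H" by (simp add: H_def)
  ultimately obtain a b where ab: "a \<noteq> 0" "\<And>q. q \<in> H \<Longrightarrow> a \<bullet> q \<le> b" "a \<bullet> (z, u z) \<ge> b"
    using separating_hyperplane_sets[of H "{(z, u z)}"] by blast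
  obtain g \<beta> where a: "a = (g, \<beta>)" by (cases a)
  have le: "g \<bullet> y + \<beta> * s \<le> g \<bullet> z + \<beta> * u z" if "y \<in> X" "s < u y" for y s
    using ab(2)[of "(y, s)"] ab(3) that by (auto simp: a H_def inner_Pair)
  have "\<beta> \<ge> 0" using le[OF zX, of "u z - 1"] by (simp add: algebra_simps)
  moreover have "\<beta> \<noteq> 0"
  proof
    assume "\<beta> = 0"
    then have "g \<noteq> 0" using ab(1) by (auto simp: a zero_prod_def)
    obtain e where e: "e > 0" "ball z e \<subseteq> X" using z by (auto simp: mem_interior)
    \<comment> \<open>With a vertical hyperplane, a step of length \<open>e / 2\<close> along its
      normal would stay in \<open>X\<close> and yet increase the product with
      \<open>g\<close>.\<close>
    define y where "y = z + (e / 2 / norm g) *\<^sub>R g"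
    have "y \<in> X"
      using e \<open>g \<noteq> 0\<close> by (intro subsetD[OF e(2)]) (simp add: y_def dist_norm)
    then have "g \<bullet> y \<le> g \<bullet> z" using le[of y "u y - 1"] \<open>\<beta> = 0\<close> by simp
    then have "(e / 2 / norm g) * (g \<bullet> g) \<le> 0"
      by (simp add: y_def inner_add_right)
    then show False
      using e mult_pos_pos[of "e / 2 / norm g" "g \<bullet> g"] \<open>g \<noteq> 0\<close> by (simp add: not_less[symmetric])
  qed
  ultimately have \<beta>: "\<beta> > 0" by simp
  have "u y \<le> u z + (- (1 / \<beta>) *\<^sub>R g) \<bullet> (y - z)" if "y \<in> X" for y
  \<comment> \<open>Separation bounds only heights strictly below \<open>u y\<close>; their supremum
    gives the claim.\<close>
  proof (rule dense_le)
    fix s assume "s < u y"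
    from le[OF that this] show "s \<le> u z + (- (1 / \<beta>) *\<^sub>R g) \<bullet> (y - z)"
      using \<beta> by (simp add: inner_diff_right field_simps)
  qed
  then show thesis by (rule that)
qed

text \<open>An interior point leaves room to increase a single good, which cannot lower
  \<open>u\<close>.\<close>

lemma mono_on_supergradient_nonneg:
  fixes u :: "real ^ 'd \<Rightarrow> real"
  assumes "mono_on X u" and z: "z \<in> interior X"
    and w: "\<And>y. y \<in> X \<Longrightarrow> u y \<le> u z + w \<bullet> (y - z)"
  shows "0 \<le> w"
  unfolding less_eq_vec_def
proof
  fix i
  obtain e where e: "e > 0" "cball z e \<subseteq> X" using z by (auto simp: mem_interior_cball)
  have "z + e *\<^sub>R axis i 1 \<in> X"
    using e by (intro subsetD[OF e(2)]) (simp add: dist_norm)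
  moreover have "u z \<le> u (z + e *\<^sub>R axis i 1)"
    using calculation z interior_subset e
    by (intro mono_onD[OF assms(1)]) (auto simp: less_eq_vec_def axis_def)
  ultimately have "0 \<le> e * w $ i"
    using w[of "z + e *\<^sub>R axis i 1"] by (simp add: inner_axis)
  then show "0 $ i \<le> w $ i" using e by (simp add: zero_le_mult_iff)
qed

section \<open>Best responses and the seller's optimal revenue\<close>

lemma mem_best_responses:
  "x \<in> best_responses X u p \<longleftrightarrow> x \<in> X \<and> (\<forall>y\<in>X. u y - p y \<le> u x - p x)"
  by (auto simp: best_responses_def is_arg_max_linorder)

lemma price_value_ge:
  "x \<in> best_responses X u p \<Longrightarrow> ereal (seller_revenue c p x) \<le> price_value X c u p"
  unfolding price_value_def by (rule SUP_upper)

lemma price_value_purchases: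
  assumes "purchases X c u p x"
  shows "price_value X c u p = ereal (seller_revenue c p x)"
proof (rule antisym)
  show "price_value X c u p \<le> ereal (seller_revenue c p x)"
    unfolding price_value_def
    using assms by (auto simp: purchases_def is_arg_max_linorder intro!: SUP_least)
  show "ereal (seller_revenue c p x) \<le> price_value X c u p"
    using assms by (auto simp: purchases_def is_arg_max_linorder intro!: price_value_ge)
qed

text \<open>A purchased bundle attains the supremum in \<open>price_value\<close>, so optimality of
  the price becomes a comparison of real revenues, against all best responses and not only
  tie-broken ones.\<close>

lemma trade_revenue_maximal:
  assumes "trade X c P u p x" "q \<in> P" "z \<in> best_responses X u q"
  shows "seller_revenue c q z \<le> seller_revenue c p x"
proof -
  have "ereal (seller_revenue c q z) \<le> price_value X c u q"
    using assms(3) by (rule price_value_ge)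
  also have "\<dots> \<le> price_value X c u p"
    using assms(1,2) by (auto simp: trade_def is_arg_max_linorder)
  also have "\<dots> = ereal (seller_revenue c p x)"
    using assms(1) by (intro price_value_purchases) (simp add: trade_def)
  finally show ?thesis by simp
qed

section \<open>Lower bound on the payment in every outcome\<close>

lemma interior_deviation:
  fixes x e w :: "real ^ 'd"
  assumes X: "feasible_set X" and u: "u \<in> imitative_values X"
    and x: "x \<in> best_responses X u (\<lambda>y. w \<bullet> y)"
    and \<alpha>: "0 \<le> \<alpha>" "\<alpha> < 1" and e: "e \<in> interior X"
  obtains w' where "0 \<le> w'" "\<alpha> *\<^sub>R x + (1 - \<alpha>) *\<^sub>R e \<in> best_responses X u (\<lambda>y. w' \<bullet> y)"
    "\<alpha> * (w \<bullet> x - w \<bullet> e) \<le> w' \<bullet> (\<alpha> *\<^sub>R x + (1 - \<alpha>) *\<^sub>R e)"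
proof -
  define z where "z = \<alpha> *\<^sub>R x + (1 - \<alpha>) *\<^sub>R e"
  have conc: "concave_on X u" and mono: "mono_on X u"
    using u by (auto simp: imitative_values_def)
  have xX: "x \<in> X" and xbest: "\<And>y. y \<in> X \<Longrightarrow> u y - w \<bullet> y \<le> u x - w \<bullet> x"
    using x by (auto simp: mem_best_responses)
  have "x - (1 - \<alpha>) *\<^sub>R (x - e) \<in> interior X"
    using \<alpha> by (intro mem_interior_convex_shrink[OF feasible_setD(2)[OF X] e xX]) auto
  also have "x - (1 - \<alpha>) *\<^sub>R (x - e) = z"
    by (simp add: z_def algebra_simps)
  finally have z: "z \<in> interior X" .
  then have zX: "z \<in> X" using interior_subset by auto
  obtain w' where w': "\<And>y. y \<in> X \<Longrightarrow> u y \<le> u z + w' \<bullet> (y - z)"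
    using concave_on_supergradient[OF conc z] by blast
  have "0 \<le> w'" using mono_on_supergradient_nonneg[OF mono z w'] .
  have "0 \<le> e" using e interior_subset feasible_setD(1)[OF X] by blast
  have we: "0 \<le> w' \<bullet> e"
    using \<open>0 \<le> w'\<close> \<open>0 \<le> e\<close> by (simp add: inner_vec_def less_eq_vec_def sum_nonneg)
  \<comment> \<open>Optimality of \<open>x\<close> against \<open>z\<close> and the supergradient at
    \<open>z\<close> tested at \<open>x\<close> place \<open>u x - u z\<close> between
    \<open>w \<bullet> (x - z)\<close> and \<open>w' \<bullet> (x - z)\<close>; the positive factor
    \<open>1 - \<alpha>\<close> then cancels.\<close>
  have "x - z = (1 - \<alpha>) *\<^sub>R (x - e)" by (simp add: z_def algebra_simps)
  then have "w \<bullet> (x - e) * (1 - \<alpha>) \<le> w' \<bullet> (x - e) * (1 - \<alpha>)"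
    using w'[OF xX] xbest[OF zX] inner_diff_right[of w x z] by (simp add: mult.commute)
  then have "w \<bullet> x - w \<bullet> e \<le> w' \<bullet> x - w' \<bullet> e"
    using \<alpha> by (simp add: inner_diff_right)
  then have "\<alpha> * (w \<bullet> x - w \<bullet> e) \<le> \<alpha> * (w' \<bullet> x)"
    using \<alpha> we by (intro mult_left_mono) auto
  also have "\<dots> \<le> w' \<bullet> z"
    using \<alpha> we by (simp add: z_def inner_add_right)
  finally have "\<alpha> * (w \<bullet> x - w \<bullet> e) \<le> w' \<bullet> z" .
  moreover have "z \<in> best_responses X u (\<lambda>y. w' \<bullet> y)"
    using zX w' by (fastforce simp: mem_best_responses inner_diff_right)
  ultimately show thesis
    using \<open>0 \<le> w'\<close> by (intro that) (auto simp: z_def)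
qed

text \<open>The interior point \<open>e\<close> may be scaled down to
  \<open>\<delta> *\<^sub>R e\<close>. As \<open>\<delta>\<close> tends to \<open>0\<close> the
  deviating bundles tend to \<open>\<alpha> *\<^sub>R x\<close>, and continuity of \<open>c\<close>
  carries the inequality to the limit.\<close>

lemma trade_ray_revenue:
  fixes x w :: "real ^ 'd"
  assumes X: "feasible_set X" and c: "continuous_on X c" and u: "u \<in> imitative_values X"
    and tr: "trade X c linear_pricing u (\<lambda>y. w \<bullet> y) x"
    and \<alpha>: "0 \<le> \<alpha>" "\<alpha> < 1"
  shows "\<alpha> * (w \<bullet> x) - c (\<alpha> *\<^sub>R x) \<le> w \<bullet> x - c x"
proof -
  note [simp] = feasible_setD(2,3)[OF X]
  have x: "x \<in> best_responses X u (\<lambda>y. w \<bullet> y)"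
    using tr by (auto simp: trade_def purchases_def is_arg_max_def)
  then have xX: "x \<in> X" by (simp add: mem_best_responses)
  obtain e where e: "e \<in> interior X" using feasible_setD(4)[OF X] by auto
  then have eX: "e \<in> X" using interior_subset by auto
  define z where "z \<delta> = \<alpha> *\<^sub>R x + (1 - \<alpha>) *\<^sub>R (\<delta> *\<^sub>R e)" for \<delta> :: real
  have zX: "z \<delta> \<in> X" if "0 \<le> \<delta>" "\<delta> \<le> 1" for \<delta>
    unfolding z_def using that \<alpha> xX eX by (intro convexD scaleR_mem_convex) auto
  have "\<alpha> * (w \<bullet> x - \<delta> * (w \<bullet> e)) - c (z \<delta>) \<le> w \<bullet> x - c x" if "0 < \<delta>" "\<delta> < 1" for \<delta>
  proof -
    have "\<delta> *\<^sub>R e \<in> interior X"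
      using mem_interior_convex_shrink[of X e 0 \<delta>] e that by simp
    then obtain w' where w': "0 \<le> w'" "z \<delta> \<in> best_responses X u (\<lambda>y. w' \<bullet> y)"
      "\<alpha> * (w \<bullet> x - w \<bullet> (\<delta> *\<^sub>R e)) \<le> w' \<bullet> z \<delta>"
      using interior_deviation[OF X u x \<alpha>] unfolding z_def by blast
    have "(\<lambda>y. w' \<bullet> y) \<in> linear_pricing" using w'(1) by (auto simp: linear_pricing_def)
    from trade_revenue_maximal[OF tr this w'(2)] w'(3) show ?thesis
      by (simp add: seller_revenue_def)
  qed
  then have "\<forall>\<^sub>F \<delta> in at_right 0. \<alpha> * (w \<bullet> x - \<delta> * (w \<bullet> e)) - c (z \<delta>) \<le> w \<bullet> x - c x"
    using eventually_at_right_real[of 0 "1::real", OF zero_less_one]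
    by (rule eventually_mono[rotated]) auto
  moreover have "((\<lambda>\<delta>. \<alpha> * (w \<bullet> x - \<delta> * (w \<bullet> e)) - c (z \<delta>)) \<longlongrightarrow>
      \<alpha> * (w \<bullet> x - 0 * (w \<bullet> e)) - c (z 0)) (at_right 0)"
  proof -
    \<comment> \<open>Continuity of \<open>c\<close> is available on \<open>X\<close> only, hence
      the limit within \<open>{0..1}\<close>, where \<open>z \<delta>\<close> stays in
      \<open>X\<close>.\<close>
    have "continuous_on {0..1} (\<lambda>\<delta>. c (z \<delta>))"
      by (rule continuous_on_compose2[OF c]) (use zX in \<open>auto simp: z_def intro!: continuous_intros\<close>)
    then have "((\<lambda>\<delta>. c (z \<delta>)) \<longlongrightarrow> c (z 0)) (at 0 within {0..1})"
      by (simp add: continuous_on)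
    then have "((\<lambda>\<delta>. c (z \<delta>)) \<longlongrightarrow> c (z 0)) (at_right 0)"
      by (simp add: at_within_Icc_at_right)
    then show ?thesis by (intro tendsto_intros)
  qed
  ultimately have "\<alpha> * (w \<bullet> x - 0 * (w \<bullet> e)) - c (z 0) \<le> w \<bullet> x - c x"
    by (intro tendsto_upperbound[where F = "at_right 0"]) auto
  then show ?thesis by (simp add: z_def)
qed

text \<open>The seller's first-order condition: selling \<open>(1 - t) *\<^sub>R x\<close> at the
  same prices brings no gain. Dividing by \<open>t\<close> bounds the difference quotients of
  \<open>c\<close> along the ray, whose limit is known.\<close>

lemma trade_payment_ge:
  fixes x :: "real ^ 'd"
  assumes X: "feasible_set X" and c: "c differentiable_on X" and u: "u \<in> imitative_values X"
    and tr: "trade X c linear_pricing u p x"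
  shows "x \<in> X" "x \<bullet> grad X c x \<le> p x"
proof -
  obtain w where p: "p = (\<lambda>y. w \<bullet> y)"
    using tr by (auto simp: trade_def is_arg_max_def linear_pricing_def)
  show xX: "x \<in> X"
    using tr by (auto simp: trade_def purchases_def is_arg_max_def best_responses_def)
  have "\<forall>\<^sub>F t in at_right 0. - (w \<bullet> x) \<le> (c ((1 - t) *\<^sub>R x) - c x) / t"
    using eventually_at_right_real[of 0 "1::real", OF zero_less_one]
  proof eventually_elim
    case (elim t)
    have "(1 - t) * (w \<bullet> x) - c ((1 - t) *\<^sub>R x) \<le> w \<bullet> x - c x"
      using elim differentiable_imp_continuous_on[OF c] tr
      by (intro trade_ray_revenue[OF X _ u]) (auto simp: p)
    then show ?case using elim by (simp add: field_simps)
  qed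
  then have "- (w \<bullet> x) \<le> - (x \<bullet> grad X c x)"
    using ray_derivative[OF feasible_setD(2,3)[OF X] xX] c xX
    by (intro tendsto_lowerbound[where F = "at_right 0"]) (auto simp: differentiable_on_def)
  then show "x \<bullet> grad X c x \<le> p x" by (simp add: p)
qed

section \<open>The Leontief function as an imitation\<close>

definition leontief_level :: "real ^ 'd \<Rightarrow> real ^ 'd \<Rightarrow> real" where
  "leontief_level a x = Min (insert 1 ((\<lambda>i. x $ i / a $ i) ` {i. a $ i \<noteq> 0}))"

lemma leontief_eq: "leontief r a x = r * leontief_level a x"
  by (simp add: leontief_def leontief_level_def)

text \<open>Replaces the minimum by coordinatewise inequalities: the level is the largest multiple
  of \<open>a\<close>, capped at 1, that \<open>x\<close> can supply in the goods that
  \<open>a\<close> contains.\<close>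

lemma leontief_level_ge_iff:
  assumes "0 \<le> a"
  shows "t \<le> leontief_level a x \<longleftrightarrow> t \<le> 1 \<and> (\<forall>i. a $ i \<noteq> 0 \<longrightarrow> t * a $ i \<le> x $ i)"
proof -
  have "t \<le> x $ i / a $ i \<longleftrightarrow> t * a $ i \<le> x $ i" if "a $ i \<noteq> 0" for i
    using that assms by (simp add: less_eq_vec_def pos_le_divide_eq order_less_le)
  then show ?thesis by (auto simp: leontief_level_def)
qed

lemma leontief_level_le:
  assumes "0 \<le> a"
  shows "leontief_level a x \<le> 1" "a $ i \<noteq> 0 \<Longrightarrow> leontief_level a x * a $ i \<le> x $ i"
  using leontief_level_ge_iff[OF assms, of "leontief_level a x" x] by auto

lemma leontief_level_nonneg: "0 \<le> a \<Longrightarrow> 0 \<le> x \<Longrightarrow> 0 \<le> leontief_level a x"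
  by (simp add: leontief_level_ge_iff less_eq_vec_def)

lemma leontief_level_self: "0 \<le> a \<Longrightarrow> leontief_level a a = 1"
  by (intro antisym leontief_level_le) (simp_all add: leontief_level_ge_iff)

text \<open>The condition at \<open>a = 0\<close> is there because the level is then constantly 1,
  so that only \<open>r = 0\<close> gives value \<open>0\<close> at the origin.\<close>

lemma leontief_imitative:
  fixes a :: "real ^ 'd"
  assumes X: "feasible_set X" and a: "0 \<le> a" and r: "0 \<le> r" "a = 0 \<Longrightarrow> r = 0"
  shows "leontief r a \<in> imitative_values X"
proof -
  note level = leontief_level_le[OF a]
  have "concave_on X (leontief r a)"
    unfolding concave_on_iff
  proof (intro conjI ballI allI impI)
    fix x y :: "real ^ 'd" and s t :: real
    assume st: "0 \<le> s" "0 \<le> t" "s + t = 1"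
    have "s * leontief_level a x + t * leontief_level a y \<le> leontief_level a (s *\<^sub>R x + t *\<^sub>R y)"
      unfolding leontief_level_ge_iff[OF a]
    proof (intro conjI allI impI)
      have "s * leontief_level a x + t * leontief_level a y \<le> s * 1 + t * 1"
        using st level(1) by (intro add_mono mult_left_mono)
      then show "s * leontief_level a x + t * leontief_level a y \<le> 1" using st by simp
      fix i assume "a $ i \<noteq> 0"
      then have "s * (leontief_level a x * a $ i) + t * (leontief_level a y * a $ i) \<le> s * x $ i + t * y $ i"
        using st level(2) by (intro add_mono mult_left_mono)
      then show "(s * leontief_level a x + t * leontief_level a y) * a $ i \<le> (s *\<^sub>R x + t *\<^sub>R y) $ i"
        by (simp add: algebra_simps)
    qed
    from mult_left_mono[OF this r(1)]
    show "s * leontief r a x + t * leontief r a y \<le> leontief r a (s *\<^sub>R x + t *\<^sub>R y)"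
      by (simp add: leontief_eq algebra_simps)
  qed (rule feasible_setD(2)[OF X])
  moreover have "mono_on X (leontief r a)"
  proof (rule mono_onI)
    fix x y :: "real ^ 'd" assume "x \<le> y"
    then have "leontief_level a x \<le> leontief_level a y"
      using level(1)[of x] level(2)[of _ x] by (force simp: leontief_level_ge_iff[OF a] less_eq_vec_def intro: order_trans)
    then show "leontief r a x \<le> leontief r a y"
      using r(1) by (simp add: leontief_eq mult_left_mono)
  qed
  moreover have "0 \<le> leontief r a x" if "x \<in> X" for x
    using that r(1) leontief_level_nonneg[OF a] feasible_setD(1)[OF X] by (simp add: leontief_eq)
  moreover have "leontief r a 0 = 0"
  proof (cases "a = 0")
    case False
    then obtain i where "a $ i \<noteq> 0" by (auto simp: vec_eq_iff)
    then have "leontief_level a 0 \<le> 0"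
      using level(2)[of i 0] a by (auto simp: less_eq_vec_def mult_le_0_iff order.antisym)
    then show ?thesis
      using leontief_level_nonneg[OF a, of 0] by (simp add: leontief_eq)
  qed (simp add: leontief_eq r(2))
  ultimately show ?thesis by (simp add: imitative_values_def)
qed

lemma leontief_revenue_le:
  fixes a x :: "real ^ 'd"
  assumes X: "feasible_set X" and c: "mono_on X c" "convex_on X c" "c differentiable_on X"
    and a: "a \<in> X" and r: "r = a \<bullet> grad X c a" and p: "p \<in> linear_pricing"
    and x: "x \<in> best_responses X (leontief r a) p"
  shows "seller_revenue c p x \<le> r - c a"
proof -
  define t where "t = leontief_level a x"
  note a0 = feasible_setD(1)[OF X a]
  have xX: "x \<in> X" using x by (simp add: mem_best_responses)
  note x0 = feasible_setD(1)[OF X xX]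
  have dc: "c differentiable (at a within X)"
    using c(3) a by (simp add: differentiable_on_def)
  have "0 \<le> r" unfolding r using X a c(1) dc by (rule inner_grad_nonneg)
  then have "leontief r a \<in> imitative_values X"
    using a0 by (intro leontief_imitative[OF X]) (auto simp: r)
  then have "leontief r a 0 = 0" by (simp add: imitative_values_def)
  moreover have "p 0 = 0" using p by (auto simp: linear_pricing_def)
  \<comment> \<open>The empty bundle has utility \<open>0\<close>, so a best response never costs
    more than its imitated value.\<close>
  ultimately have px: "p x \<le> r * t"
    using x feasible_setD(3)[OF X] by (auto simp: mem_best_responses leontief_eq t_def)
  have t: "0 \<le> t" "t \<le> 1"
    using leontief_level_nonneg[OF a0 x0] leontief_level_le(1)[OF a0] by (auto simp: t_def)
  have "c a - (1 - t) * r \<le> c (t *\<^sub>R a)"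
    unfolding r using t by (intro convex_on_ray_ge[OF c(2) feasible_setD(3)[OF X] a dc])
  also have "\<dots> \<le> c x"
  proof (rule mono_onD[OF c(1) _ xX])
    show "t *\<^sub>R a \<in> X"
      using feasible_setD(2,3)[OF X] a t by (rule scaleR_mem_convex)
    \<comment> \<open>Goods with \<open>a $ i = 0\<close> do not enter the level; for them
      nonnegativity of \<open>x\<close> suffices.\<close>
    have "t * a $ i \<le> x $ i" for i
      using leontief_level_le(2)[OF a0, of i x] x0
      by (cases "a $ i = 0") (auto simp: t_def less_eq_vec_def)
    then show "t *\<^sub>R a \<le> x" by (simp add: less_eq_vec_def)
  qed
  finally have "p x - c x \<le> r * t - c a + (1 - t) * r"
    using px by linarith
  then show ?thesis by (simp add: seller_revenue_def algebra_simps)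
qed

text \<open>The whole payment is loaded on one good \<open>i\<close> contained in \<open>a\<close>,
  at unit price \<open>r / a $ i\<close>. The level is at most the ratio of that good, so imitated
  utility is at most \<open>0\<close> on \<open>X\<close> and equals \<open>0\<close> at
  \<open>a\<close>. For \<open>a = 0\<close> the zero price works.\<close>

lemma leontief_supporting_price:
  fixes a :: "real ^ 'd"
  assumes X: "feasible_set X" and a: "a \<in> X" and r: "0 \<le> r" "a = 0 \<Longrightarrow> r = 0"
  obtains p where "p \<in> linear_pricing" "p a = r" "a \<in> best_responses X (leontief r a) p"
proof -
  note a0 = feasible_setD(1)[OF X a]
  obtain w :: "real ^ 'd" where w: "0 \<le> w" "w \<bullet> a = r"
    and le: "\<And>x. x \<in> X \<Longrightarrow> leontief r a x \<le> w \<bullet> x"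
  proof (cases "a = 0")
    case True
    then show thesis using r by (intro that[of 0]) (auto simp: leontief_eq)
  next
    case False
    then obtain i where i: "a $ i \<noteq> 0" by (auto simp: vec_eq_iff)
    then have ai: "0 < a $ i" using a0 by (simp add: less_eq_vec_def order_less_le)
    show thesis
    proof (rule that[of "axis i (r / a $ i)"])
      show "0 \<le> axis i (r / a $ i)" using r ai by (auto simp: less_eq_vec_def axis_def)
      show "axis i (r / a $ i) \<bullet> a = r" using ai by (simp add: inner_axis')
      fix x
      have "leontief_level a x \<le> x $ i / a $ i"
        using leontief_level_le(2)[OF a0 i, of x] ai by (simp add: pos_le_divide_eq)
      from mult_left_mono[OF this r(1)]
      show "leontief r a x \<le> axis i (r / a $ i) \<bullet> x"
        by (simp add: leontief_eq inner_axis')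
    qed
  qed
  show thesis
  proof (rule that[of "\<lambda>x. w \<bullet> x"])
    show "(\<lambda>x. w \<bullet> x) \<in> linear_pricing" using w(1) by (auto simp: linear_pricing_def)
    show "a \<in> best_responses X (leontief r a) (\<lambda>x. w \<bullet> x)"
      using a le w(2) by (auto simp: mem_best_responses leontief_eq leontief_level_self[OF a0])
  qed (rule w(2))
qed

theorem theorem2:
  fixes X :: "(real ^ 'd) set"
    and c v ustar :: "real ^ 'd \<Rightarrow> real"
    and xstar :: "real ^ 'd"
    and pstar :: real
  assumes X: "feasible_set X"
    and c: "mono_on X c" "c 0 = 0" "convex_on X c" "c differentiable_on X"
    and v: "concave_on X v" "mono_on X v" "v 0 = 0"
    and xstar: "is_arg_max (\<lambda>x. v x - x \<bullet> grad X c x) (\<lambda>x. x \<in> X) xstar"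
    and pstar: "pstar = xstar \<bullet> grad X c xstar"
    and ustar: "ustar = leontief pstar xstar"
  shows "(\<exists>p. optimal_imitation X c linear_pricing v ustar p xstar
           \<and> p xstar = pstar
           \<and> seller_revenue c p xstar = xstar \<bullet> grad X c xstar - c xstar
           \<and> buyer_surplus v p xstar = v xstar - xstar \<bullet> grad X c xstar)
       \<and> xstar \<bullet> grad X c xstar - c xstar = bregman X c 0 xstar
       \<and> (\<forall>p x. trade X c linear_pricing ustar p x \<longrightarrow> seller_revenue c p x = bregman X c 0 xstar)"
proof -
  have sX: "xstar \<in> X"
    and smax: "\<And>x. x \<in> X \<Longrightarrow> v x - x \<bullet> grad X c x \<le> v xstar - pstar"
    using xstar by (auto simp: is_arg_max_linorder pstar)
  have "c differentiable (at xstar within X)"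
    using c(4) sX by (simp add: differentiable_on_def)
  then have r: "0 \<le> pstar" "xstar = 0 \<Longrightarrow> pstar = 0"
    unfolding pstar using inner_grad_nonneg[OF X sX c(1)] by auto
  have uC: "ustar \<in> imitative_values X"
    unfolding ustar using X feasible_setD(1)[OF X sX] r by (rule leontief_imitative)
  obtain p where p: "p \<in> linear_pricing" "p xstar = pstar" "xstar \<in> best_responses X ustar p"
    unfolding ustar using leontief_supporting_price[OF X sX r] by blast
  have rev: "seller_revenue c p xstar = pstar - c xstar"
    by (simp add: seller_revenue_def p(2))
  have rev_le: "seller_revenue c q x \<le> pstar - c xstar"
    if "q \<in> linear_pricing" "x \<in> best_responses X ustar q" for q x
    using leontief_revenue_le[OF X c(1,3,4) sX pstar that(1)] that(2) by (simp add: ustar)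
  \<comment> \<open>The revenue bound covers all linear prices and is reached at
    \<open>xstar\<close>, so \<open>xstar\<close> passes the tie-breaking and \<open>p\<close> is an
    optimal price.\<close>
  have pur: "purchases X c ustar p xstar"
    using p rev_le rev by (auto simp: purchases_def is_arg_max_linorder)
  have "price_value X c ustar q \<le> price_value X c ustar p" if "q \<in> linear_pricing" for q
    unfolding price_value_purchases[OF pur] rev
    unfolding price_value_def using rev_le[OF that] by (intro SUP_least) simp
  with p(1) pur have tr: "trade X c linear_pricing ustar p xstar"
    by (simp add: trade_def is_arg_max_linorder)
  \<comment> \<open>The lower bound on the payment caps the surplus by the objective that
    \<open>xstar\<close> maximizes.\<close>
  have "buyer_surplus v p' x' \<le> buyer_surplus v p xstar"
    if "u' \<in> imitative_values X" "trade X c linear_pricing u' p' x'" for u' p' x'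
    using trade_payment_ge[OF X c(4) that] smax[of x'] by (simp add: buyer_surplus_def p(2))
  with uC tr have opt: "optimal_imitation X c linear_pricing v ustar p xstar"
    by (auto simp: optimal_imitation_def)
  have breg: "pstar - c xstar = bregman X c 0 xstar"
    by (simp add: bregman_def c(2) pstar inner_commute)
  \<comment> \<open>Whatever outcome arises, \<open>rev_le\<close> caps its revenue, and the seller
    could offer \<open>p\<close> instead, to which \<open>xstar\<close> is a best response.\<close>
  have "seller_revenue c q x = bregman X c 0 xstar" if "trade X c linear_pricing ustar q x" for q x
  proof -
    have "q \<in> linear_pricing" "x \<in> best_responses X ustar q"
      using that by (auto simp: trade_def purchases_def is_arg_max_def)
    then have "seller_revenue c q x \<le> pstar - c xstar" by (rule rev_le)
    moreover have "pstar - c xstar \<le> seller_revenue c q x"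
      using trade_revenue_maximal[OF that p(1,3)] rev by simp
    ultimately show ?thesis using breg by simp
  qed
  with opt p(2) rev breg show ?thesis
    by (auto simp: buyer_surplus_def pstar)
qed

end
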